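(* Let $p,q>1$ satisfy $\frac1p+\frac1q=1$, and let $f,g\in C([0,1])$. Suppose that $\zeta_f^{(p)}\in\ell^p(\mathbb N_{-1})$ and $\zeta_g^{(q)}\in\ell^q(\mathbb N_{-1})$. If the Faber--Schauder integral $I_{f,g}$ exists on $[0,1]$, then $I_{g,f}^{\mathbb T}$ also admits a unique continuous extension to $[0,1]$, given by $$I_{g,f}(t)=f(t)g(t)-f(0)g(0)-I_{f,g}(t),\qquad t\in[0,1].$$ Equivalently, for every $s,t\in[0,1]$, $$\int_s^t f\,dg+\int_s^t g\,df=f(t)g(t)-f(s)g(s).$$
   Context: $C([0,1])$ denotes the real-valued continuous functions on $[0,1]$. $\mathbb N_0=\{0,1,2,\dots\}$, $\mathbb N_{-1}=\{-1,0,1,\dots\}$. For $n\in\mathbb N_0$: $t_{n,k}=k2^{-n}$ for $0\le k\le 2^n$, $\mathbb T_n=\{t_{n,k}:0\le k\le 2^n\}$, $\mathbb T=\bigcup_{n\ge0}\mathbb T_n$, $I_n=\{0,\dots,2^n-1\}$; for $t\in\mathbb T$, $\ell(t)=\min\{m\ge0:t\in\mathbb T_m\}$. Dyadic left sums: for $f,g\in C([0,1])$, $t\in\mathbb T$, $n\ge\ell(t)$, $$S_n^L(t;f,g)=\sum_{k=0}^{2^nt-1}f(t_{n,k})\big(g(t_{n,k+1})-g(t_{n,k})\big)$$ (empty sum $=0$). The dyadic integral over $[0,t]$ exists if $(S_n^L(t;f,g))_{n\ge\ell(t)}$ converges, and its limit is denoted $I^{\mathbb T}_{f,g}(t)$.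 (Under the stated hypotheses on level energies, both $I^{\mathbb T}_{f,g}$ and $I^{\mathbb T}_{g,f}$ are well-defined on $\mathbb T$.) Faber--Schauder integral: if $I^{\mathbb T}_{f,g}(t)$ exists for every $t\in\mathbb T$ and the map $I^{\mathbb T}_{f,g}:\mathbb T\to\mathbb R$ admits a (necessarily unique) continuous extension to $[0,1]$, this extension is denoted $I_{f,g}:[0,1]\to\mathbb R$ and one says that the Faber--Schauder integral $I_{f,g}$ exists on $[0,1]$. In that case $\int_s^t f\,dg:=I_{f,g}(t)-I_{f,g}(s)$ for all $s,t\in[0,1]$. Faber--Schauder coefficients of $f\in C([0,1])$: $\theta^f_{-1,0}=f(1)-f(0)$, and for $n\ge0$, $k\in I_n$, $\theta^f_{n,k}=2^{n/2}\big(2f(t_{n+1,2k+1})-f(t_{n,k})-f(t_{n,k+1})\big)$. Level energies ($p>1$): $\zeta_f^{(p)}=(\zeta_f^{(p)}(n))_{n\in\mathbb N_{-1}}$ with $\zeta_f^{(p)}(-1)=2^{1-\frac1p}|\theta^f_{-1,0}|$ and $\zeta_f^{(p)}(n)=\big(2^{-np/2}\sum_{k\in I_n}|\theta^f_{n,k}|^p\big)^{1/p}$ for $n\ge0$. *)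

theory Defs
  imports "HOL-Analysis.Analysis" "HOL-Library.FuncSet"
begin

text \<open>
  An element of \<open>C([0,1])\<close> is represented by a total function \<open>f :: real \<Rightarrow> real\<close> with
  \<open>continuous_on {0..1} f\<close>; only its values on \<open>[0,1]\<close> enter the notions below.
\<close>

definition dyadic_pt :: "nat \<Rightarrow> nat \<Rightarrow> real" where
  "dyadic_pt n k = real k / 2 ^ n"

definition dyadic_grid :: "nat \<Rightarrow> real set" where
  "dyadic_grid n = {dyadic_pt n k | k. k \<le> 2 ^ n}"

definition dyadic_set :: "real set" where
  "dyadic_set = (\<Union>n. dyadic_grid n)"

definition dyadic_level :: "real \<Rightarrow> nat" where
  "dyadic_level t = (LEAST m. t \<in> dyadic_grid m)"

text \<open>For \<open>n \<ge> dyadic_level t\<close> the number \<open>2 ^ n * t\<close> is a natural number, so the floor is exact.\<close>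

definition left_sum :: "(real \<Rightarrow> real) \<Rightarrow> (real \<Rightarrow> real) \<Rightarrow> real \<Rightarrow> nat \<Rightarrow> real" where
  "left_sum f g t n =
     (\<Sum>k<nat \<lfloor>2 ^ n * t\<rfloor>. f (dyadic_pt n k) * (g (dyadic_pt n (Suc k)) - g (dyadic_pt n k)))"

text \<open>The sequence of left sums is indexed by \<open>n \<ge> dyadic_level t\<close>, written as
  \<open>n = dyadic_level t + j\<close>.\<close>

definition dyadic_integrable :: "(real \<Rightarrow> real) \<Rightarrow> (real \<Rightarrow> real) \<Rightarrow> real \<Rightarrow> bool" where
  "dyadic_integrable f g t \<longleftrightarrow> convergent (\<lambda>j. left_sum f g t (dyadic_level t + j))"

definition dyadic_integral :: "(real \<Rightarrow> real) \<Rightarrow> (real \<Rightarrow> real) \<Rightarrow> real \<Rightarrow> real" where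
  "dyadic_integral f g t = lim (\<lambda>j. left_sum f g t (dyadic_level t + j))"

text \<open>Functions on \<open>[0,1]\<close> are taken extensional, so that uniqueness of an extension is
  literal uniqueness of a function.\<close>

definition continuous_extension :: "(real \<Rightarrow> real) \<Rightarrow> (real \<Rightarrow> real) \<Rightarrow> bool" where
  "continuous_extension \<phi> h \<longleftrightarrow>
     h \<in> extensional {0..1} \<and> continuous_on {0..1} h \<and> (\<forall>t\<in>dyadic_set. h t = \<phi> t)"

definition FS_integral_exists :: "(real \<Rightarrow> real) \<Rightarrow> (real \<Rightarrow> real) \<Rightarrow> bool" where
  "FS_integral_exists f g \<longleftrightarrow>
     (\<forall>t\<in>dyadic_set. dyadic_integrable f g t) \<and>
     (\<exists>h. continuous_extension (dyadic_integral f g) h)"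

definition FS_integral :: "(real \<Rightarrow> real) \<Rightarrow> (real \<Rightarrow> real) \<Rightarrow> real \<Rightarrow> real" where
  "FS_integral f g = (THE h. continuous_extension (dyadic_integral f g) h)"

definition FS_integral_between ::
    "(real \<Rightarrow> real) \<Rightarrow> (real \<Rightarrow> real) \<Rightarrow> real \<Rightarrow> real \<Rightarrow> real" where
  "FS_integral_between f g s t = FS_integral f g t - FS_integral f g s"

text \<open>Levels range over \<open>{-1..} :: int set\<close>; at level \<open>-1\<close> only \<open>k = 0\<close> is meaningful.\<close>

definition FS_coeff :: "(real \<Rightarrow> real) \<Rightarrow> int \<Rightarrow> nat \<Rightarrow> real" where
  "FS_coeff f n k =
     (if n = -1 then f 1 - f 0
      else 2 powr (real_of_int n / 2) *
        (2 * f (dyadic_pt (nat n + 1) (2 * k + 1))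
           - f (dyadic_pt (nat n) k) - f (dyadic_pt (nat n) (k + 1))))"

definition level_energy :: "real \<Rightarrow> (real \<Rightarrow> real) \<Rightarrow> int \<Rightarrow> real" where
  "level_energy p f n =
     (if n = -1 then 2 powr (1 - 1 / p) * \<bar>FS_coeff f (-1) 0\<bar>
      else (2 powr (- (real_of_int n * p / 2)) *
             (\<Sum>k<2 ^ nat n. \<bar>FS_coeff f n k\<bar> powr p)) powr (1 / p))"

definition in_lp :: "real \<Rightarrow> 'a set \<Rightarrow> ('a \<Rightarrow> real) \<Rightarrow> bool" where
  "in_lp p A a \<longleftrightarrow> (\<lambda>n. \<bar>a n\<bar> powr p) summable_on A"

end

theory Submission
  imports Defs
begin

text \<open>
  Summation by parts on the grid of level \<open>n\<close> gives, for every dyadic \<open>t\<close> of level at most \<open>n\<close>,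
  \<open>S_n(t; f, g) + S_n(t; g, f) + [f, g]_n(t) = f(t) g(t) - f(0) g(0)\<close>, where \<open>[f, g]_n(t)\<close> is the
  sum of the products of the increments of \<open>f\<close> and \<open>g\<close> up to \<open>t\<close> (\<open>left_sums_by_parts\<close>).
  The whole point is that this bracket tends to \<open>0\<close>.

  By Young's inequality, \<open>[f, g]_n\<close> is dominated by the sums \<open>V_n\<close> of the \<open>p\<close>-th powers of the
  increments of \<open>f\<close> and of the \<open>q\<close>-th powers of those of \<open>g\<close> (\<open>bracket_le_power_variation\<close>), so it
  suffices to see that each of these tends to \<open>0\<close>. Passing to the next level
  replaces an increment \<open>x\<close> by the two increments \<open>(x + d) / 2\<close> and \<open>(x - d) / 2\<close>, where \<open>d\<close> is the
  second difference at the midpoint. If \<open>d\<close> vanished throughout, \<open>V_n\<close> would be multiplied by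
  \<open>2 powr (1 - p) < 1\<close>. A weighted convexity inequality splits off \<open>d\<close> at the price of a slightly
  worse factor, which is still below \<open>1\<close>:
  \<open>V_(n+1) \<le> (3/2) powr (1 - p) * V_n + 2 powr (p - 1) * E_n\<close>, where \<open>E_n\<close> is the sum of the \<open>p\<close>-th powers of
  the second differences (\<open>power_variation_Suc_le\<close>). Now \<open>E_n\<close> is the \<open>p\<close>-th power of the
  level energy, hence summable by hypothesis, and a contractive recursion with summable forcing
  has a summable solution. Thus \<open>V_n\<close> tends to \<open>0\<close> (\<open>power_variation_tendsto_0\<close>).

  In the limit the two dyadic integrals add up to \<open>f(t) g(t) - f(0) g(0)\<close> at every dyadic \<open>t\<close>.
  So \<open>f g - f(0) g(0) - I_(f,g)\<close> is a continuous extension of the dyadic integral of \<open>g\<close>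
  against \<open>f\<close>, and it is the only one because dyadic points are dense.
\<close>

section \<open>Dyadic points\<close>

lemma dyadic_grid_mono: "m \<le> n \<Longrightarrow> dyadic_grid m \<subseteq> dyadic_grid n"
proof (rule lift_Suc_mono_le[of dyadic_grid])
  show "dyadic_grid n \<subseteq> dyadic_grid (Suc n)" for n
  proof
    fix t assume "t \<in> dyadic_grid n"
    then obtain k where k: "k \<le> 2 ^ n" "t = dyadic_pt n k"
      by (auto simp: dyadic_grid_def)
    then have "t = dyadic_pt (Suc n) (2 * k)" "2 * k \<le> 2 ^ Suc n"
      by (auto simp: dyadic_pt_def)
    then show "t \<in> dyadic_grid (Suc n)"
      unfolding dyadic_grid_def by blast
  qed
qed

lemma dyadic_grid_dyadic_level:
  assumes "t \<in> dyadic_set"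
  shows "t \<in> dyadic_grid (dyadic_level t)"
  using assms unfolding dyadic_set_def dyadic_level_def by (auto intro: LeastI)

lemma dyadic_set_subset: "dyadic_set \<subseteq> {0..1}"
  by (auto simp: dyadic_set_def dyadic_grid_def dyadic_pt_def divide_le_eq)

lemma closure_dyadic_set: "closure dyadic_set = {0..1}"
proof -
  have "{0..1::real} \<inter> (\<Union>k m. {of_nat m / 2 ^ k}) \<subseteq> dyadic_set"
    by (auto simp: dyadic_set_def dyadic_grid_def dyadic_pt_def divide_le_eq)
  then have "closure ({0..1::real} \<inter> (\<Union>k m. {of_nat m / 2 ^ k})) \<subseteq> closure dyadic_set"
    by (rule closure_mono)
  moreover have "closure ({0..1::real} \<inter> (\<Union>k m. {of_nat m / 2 ^ k})) = {0..1}"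
    by (subst closure_dyadic_rationals_in_convex_set_pos_1) auto
  moreover have "closure dyadic_set \<subseteq> {0..1}"
    by (rule closure_minimal[OF dyadic_set_subset]) simp
  ultimately show ?thesis by blast
qed

lemma continuous_extension_unique:
  assumes "continuous_extension \<phi> h" "continuous_extension \<phi> h'"
  shows "h = h'"
proof (rule extensionalityI[where A = "{0..1}"])
  fix x :: real assume "x \<in> {0..1}"
  have "h x - h' x = 0"
  proof (rule continuous_constant_on_closure[where S = dyadic_set and f = "\<lambda>x. h x - h' x"])
    show "continuous_on (closure dyadic_set) (\<lambda>x. h x - h' x)"
      using assms by (auto simp: closure_dyadic_set continuous_extension_def intro!: continuous_intros)
  qed (use assms \<open>x \<in> {0..1}\<close> in \<open>auto simp: closure_dyadic_set continuous_extension_def\<close>)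
  then show "h x = h' x" by simp
qed (use assms in \<open>auto simp: continuous_extension_def\<close>)

lemma FS_integral_eqI:
  assumes "continuous_extension (dyadic_integral f g) h"
  shows "FS_integral f g = h"
  unfolding FS_integral_def
  using the_equality[where P = "continuous_extension (dyadic_integral f g)", OF assms]
    continuous_extension_unique[OF _ assms] .

section \<open>Decay of the power variation along dyadic levels\<close>

text \<open>
  This is convexity of \<open>x powr p\<close> applied to
  \<open>x + y = (1 - \<mu>) * (x / (1 - \<mu>)) + \<mu> * (y / \<mu>)\<close>. Compared with the symmetric choice
  \<open>\<mu> = 1/2\<close>, a small \<open>\<mu>\<close> keeps the constant in front of \<open>x\<close> close to \<open>1\<close>.
\<close>
lemma abs_add_powr_le_weighted:
  fixes x y p \<mu> :: real
  assumes "p \<ge> 1" "0 < \<mu>" "\<mu> < 1"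
  shows "\<bar>x + y\<bar> powr p \<le> (1 - \<mu>) powr (1 - p) * \<bar>x\<bar> powr p + \<mu> powr (1 - p) * \<bar>y\<bar> powr p"
proof -
  have weight: "w * (a / w) powr p = w powr (1 - p) * a powr p" if "w > 0" "a \<ge> 0" for w a :: real
    using that by (simp add: powr_divide powr_diff)
  have weight_ge: "a powr p \<le> w powr (1 - p) * a powr p" if "0 < w" "w < 1" for w a :: real
  proof -
    have "1 powr (1 - p) \<le> w powr (1 - p)"
      using that assms by (intro powr_mono2') auto
    then show ?thesis by (simp add: mult_le_cancel_right1)
  qed
  consider "x = 0" | "y = 0" | "\<bar>x\<bar> > 0" "\<bar>y\<bar> > 0" by fastforce
  then show ?thesis
  proof cases
    case 1
    then show ?thesis using weight_ge[of \<mu> "\<bar>y\<bar>"] assms by simp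
  next
    case 2
    then show ?thesis using weight_ge[of "1 - \<mu>" "\<bar>x\<bar>"] assms by simp
  next
    case 3
    have "\<bar>x + y\<bar> powr p \<le> (\<bar>x\<bar> + \<bar>y\<bar>) powr p"
      using assms by (intro powr_mono2) auto
    also have "\<dots> = ((1 - \<mu>) *\<^sub>R (\<bar>x\<bar> / (1 - \<mu>)) + \<mu> *\<^sub>R (\<bar>y\<bar> / \<mu>)) powr p"
      using assms by simp
    also have "\<dots> \<le> (1 - \<mu>) * (\<bar>x\<bar> / (1 - \<mu>)) powr p + \<mu> * (\<bar>y\<bar> / \<mu>) powr p"
      using assms 3 by (intro convex_onD[OF powr_convex]) auto
    finally show ?thesis using assms by (simp add: weight)
  qed
qed

text \<open>
  Summing the recursion bounds a partial sum \<open>X\<close> of \<open>x\<close> by \<open>x 0 + c * X + suminf e\<close>,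
  and \<open>c < 1\<close> allows solving for \<open>X\<close>.
\<close>
lemma summable_contractive_recursion:
  fixes x e :: "nat \<Rightarrow> real"
  assumes x: "\<And>n. x n \<ge> 0" and e: "\<And>n. e n \<ge> 0" "summable e"
    and c: "0 \<le> c" "c < 1"
    and rec: "\<And>n. x (Suc n) \<le> c * x n + e n"
  shows "summable x"
proof (rule bounded_imp_summable[where B = "(x 0 + suminf e) / (1 - c)"])
  fix n
  have "(\<Sum>k\<le>n. x k) = x 0 + (\<Sum>k<n. x (Suc k))"
    by (simp add: sum.atMost_shift)
  also have "\<dots> \<le> x 0 + (\<Sum>k<n. c * x k + e k)"
    by (intro add_left_mono sum_mono rec)
  also have "\<dots> = x 0 + c * (\<Sum>k<n. x k) + (\<Sum>k<n. e k)"
    by (simp add: sum.distrib sum_distrib_left)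
  also have "\<dots> \<le> x 0 + c * (\<Sum>k\<le>n. x k) + suminf e"
    using x e c by (intro add_mono mult_left_mono sum_mono2 sum_le_suminf) auto
  finally show "(\<Sum>k\<le>n. x k) \<le> (x 0 + suminf e) / (1 - c)"
    using c by (simp add: field_simps)
qed (rule x)

definition dyadic_incr :: "(real \<Rightarrow> real) \<Rightarrow> nat \<Rightarrow> nat \<Rightarrow> real" where
  "dyadic_incr f n k = f (dyadic_pt n (Suc k)) - f (dyadic_pt n k)"

text \<open>These are the Faber--Schauder coefficients without their normalising factor.\<close>
definition second_diff :: "(real \<Rightarrow> real) \<Rightarrow> nat \<Rightarrow> nat \<Rightarrow> real" where
  "second_diff f n k =
     2 * f (dyadic_pt (Suc n) (2 * k + 1)) - f (dyadic_pt n k) - f (dyadic_pt n (Suc k))"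

definition power_variation :: "real \<Rightarrow> (real \<Rightarrow> real) \<Rightarrow> nat \<Rightarrow> real" where
  "power_variation p f n = (\<Sum>k<2 ^ n. \<bar>dyadic_incr f n k\<bar> powr p)"

text \<open>The \<open>p\<close>-th power of the normalising factor \<open>2 powr (n / 2)\<close> of the coefficients cancels
  the factor in front of the sum.\<close>
lemma level_energy_powr:
  assumes "p > 0"
  shows "level_energy p f (int n) powr p = (\<Sum>k<2 ^ n. \<bar>second_diff f n k\<bar> powr p)"
proof -
  have "\<bar>FS_coeff f (int n) k\<bar> powr p = 2 powr (real n * p / 2) * \<bar>second_diff f n k\<bar> powr p" for k
    by (simp add: FS_coeff_def second_diff_def abs_mult powr_mult powr_powr)
  then have "2 powr (- (real n * p / 2)) * (\<Sum>k<2 ^ n. \<bar>FS_coeff f (int n) k\<bar> powr p)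
      = (\<Sum>k<2 ^ n. \<bar>second_diff f n k\<bar> powr p)"
    by (simp add: sum_distrib_left[symmetric] mult.assoc[symmetric] powr_add[symmetric])
  then show ?thesis
    using assms by (simp add: level_energy_def powr_powr sum_nonneg)
qed

lemma summable_second_diff:
  assumes "p > 0" "in_lp p {-1..} (level_energy p f)"
  shows "summable (\<lambda>n. \<Sum>k<2 ^ n. \<bar>second_diff f n k\<bar> powr p)"
proof -
  have "(\<lambda>n. \<bar>level_energy p f n\<bar> powr p) summable_on range int"
    using assms(2) unfolding in_lp_def by (rule summable_on_subset_banach) auto
  then have "(\<lambda>n. \<bar>level_energy p f (int n)\<bar> powr p) summable_on UNIV"
    by (subst (asm) summable_on_reindex) (auto simp: o_def)
  moreover have "\<bar>level_energy p f (int n)\<bar> = level_energy p f (int n)" for n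
    by (simp add: level_energy_def)
  ultimately show ?thesis
    using assms(1)
    by (subst (asm) summable_on_UNIV_nonneg_real_iff) (auto simp: level_energy_powr sum_nonneg)
qed

text \<open>
  With weights \<open>\<mu> = 1/4\<close> and \<open>1 - \<mu> = 3/4\<close>, each of the two children \<open>(x \<plusminus> d) / 2\<close> contributes
  \<open>2 powr (-p) * (3/4) powr (1 - p) * \<bar>x\<bar> powr p\<close>, so together the factor is \<open>(3/2) powr (1 - p)\<close>. Any
  \<open>\<mu> < 1/2\<close> would give a factor below \<open>1\<close>.
\<close>
lemma power_variation_Suc_le:
  assumes "p \<ge> 1"
  shows "power_variation p f (Suc n)
    \<le> (3/2) powr (1 - p) * power_variation p f n
      + 2 powr (p - 1) * (\<Sum>k<2 ^ n. \<bar>second_diff f n k\<bar> powr p)"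
proof -
  have child: "\<bar>(x + d) / 2\<bar> powr p
      \<le> ((3/2) powr (1 - p) * \<bar>x\<bar> powr p + 2 powr (p - 1) * \<bar>d\<bar> powr p) / 2" for x d :: real
  proof -
    have "\<bar>(x + d) / 2\<bar> powr p = 2 powr (- p) * \<bar>x + d\<bar> powr p"
      by (simp add: powr_divide powr_minus field_simps)
    also have "\<dots> \<le> 2 powr (- p) * ((3/4) powr (1 - p) * \<bar>x\<bar> powr p + (1/4) powr (1 - p) * \<bar>d\<bar> powr p)"
      using abs_add_powr_le_weighted[of p "1/4" x d] assms by (intro mult_left_mono) auto
    also have "\<dots> = ((2 powr (1 - p) * (3/4) powr (1 - p)) * \<bar>x\<bar> powr p
        + (2 powr (1 - p) * (1/4) powr (1 - p)) * \<bar>d\<bar> powr p) / 2"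
      by (simp add: powr_diff powr_minus field_simps)
    also have "2 powr (1 - p) * (3/4) powr (1 - p) = (3/2 :: real) powr (1 - p)"
      by (simp flip: powr_mult)
    also have "2 powr (1 - p) * (1/4) powr (1 - p) = (1/2 :: real) powr (1 - p)"
      by (simp flip: powr_mult)
    also have "(1/2 :: real) powr (1 - p) = 2 powr (p - 1)"
      by (simp add: powr_divide powr_diff)
    finally show ?thesis .
  qed
  have left: "dyadic_incr f (Suc n) (2 * k) = (dyadic_incr f n k + second_diff f n k) / 2"
    and right: "dyadic_incr f (Suc n) (2 * k + 1) = (dyadic_incr f n k + - second_diff f n k) / 2" for k
  proof -
    have "dyadic_pt (Suc n) (2 * k) = dyadic_pt n k" "dyadic_pt (Suc n) (Suc (Suc (2 * k))) = dyadic_pt n (Suc k)"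
      by (simp_all add: dyadic_pt_def field_simps)
    then show "dyadic_incr f (Suc n) (2 * k) = (dyadic_incr f n k + second_diff f n k) / 2"
      and "dyadic_incr f (Suc n) (2 * k + 1) = (dyadic_incr f n k + - second_diff f n k) / 2"
      by (simp_all add: dyadic_incr_def second_diff_def)
  qed
  have "power_variation p f (Suc n)
      = (\<Sum>k<2 ^ n. \<bar>dyadic_incr f (Suc n) (2 * k)\<bar> powr p)
        + (\<Sum>k<2 ^ n. \<bar>dyadic_incr f (Suc n) (2 * k + 1)\<bar> powr p)"
    using sum_split_even_odd[of "\<lambda>k. \<bar>dyadic_incr f (Suc n) k\<bar> powr p"
        "\<lambda>k. \<bar>dyadic_incr f (Suc n) k\<bar> powr p" "2 ^ n"]
    by (simp add: power_variation_def)
  also have "\<dots> = (\<Sum>k<2 ^ n. \<bar>(dyadic_incr f n k + second_diff f n k) / 2\<bar> powr p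
        + \<bar>(dyadic_incr f n k + - second_diff f n k) / 2\<bar> powr p)"
    by (simp only: left right sum.distrib)
  also have "\<dots> \<le> (\<Sum>k<2 ^ n. (3/2) powr (1 - p) * \<bar>dyadic_incr f n k\<bar> powr p
      + 2 powr (p - 1) * \<bar>second_diff f n k\<bar> powr p)"
  proof (rule sum_mono)
    fix k
    show "\<bar>(dyadic_incr f n k + second_diff f n k) / 2\<bar> powr p
        + \<bar>(dyadic_incr f n k + - second_diff f n k) / 2\<bar> powr p
        \<le> (3/2) powr (1 - p) * \<bar>dyadic_incr f n k\<bar> powr p
      + 2 powr (p - 1) * \<bar>second_diff f n k\<bar> powr p"
      using child[of "dyadic_incr f n k" "second_diff f n k"]
        child[of "dyadic_incr f n k" "- second_diff f n k"]
      unfolding abs_minus_cancel by argo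
  qed
  finally show ?thesis
    by (simp add: power_variation_def sum.distrib sum_distrib_left)
qed

lemma power_variation_tendsto_0:
  assumes "p > 1" "in_lp p {-1..} (level_energy p f)"
  shows "power_variation p f \<longlonglongrightarrow> 0"
proof (rule summable_LIMSEQ_zero, rule summable_contractive_recursion)
  show "power_variation p f (Suc n) \<le> (3/2) powr (1 - p) * power_variation p f n
      + 2 powr (p - 1) * (\<Sum>k<2 ^ n. \<bar>second_diff f n k\<bar> powr p)" for n
    using assms by (intro power_variation_Suc_le) simp
  show "summable (\<lambda>n. 2 powr (p - 1) * (\<Sum>k<2 ^ n. \<bar>second_diff f n k\<bar> powr p))"
    using assms by (intro summable_mult summable_second_diff) auto
  have "(3/2 :: real) powr (1 - p) < (3/2) powr 0"
    using assms by (intro powr_less_mono) auto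
  then show "(3/2 :: real) powr (1 - p) < 1" by simp
qed (auto simp: power_variation_def sum_nonneg)

section \<open>Integration by parts\<close>

lemma left_sum_dyadic_pt:
  "left_sum f g (dyadic_pt n m) n = (\<Sum>k<m. f (dyadic_pt n k) * dyadic_incr g n k)"
  by (simp add: left_sum_def dyadic_incr_def dyadic_pt_def)

text \<open>
  With \<open>a' = a + \<Delta>a\<close> and \<open>b' = b + \<Delta>b\<close>, one has \<open>a \<Delta>b + b \<Delta>a + \<Delta>a \<Delta>b = a' b' - a b\<close>, and the
  right-hand side telescopes.
\<close>
lemma left_sums_by_parts:
  "left_sum f g (dyadic_pt n m) n + left_sum g f (dyadic_pt n m) n
     + (\<Sum>k<m. dyadic_incr f n k * dyadic_incr g n k)
   = f (dyadic_pt n m) * g (dyadic_pt n m) - f 0 * g 0"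
proof -
  have "left_sum f g (dyadic_pt n m) n + left_sum g f (dyadic_pt n m) n
     + (\<Sum>k<m. dyadic_incr f n k * dyadic_incr g n k)
     = (\<Sum>k<m. f (dyadic_pt n (Suc k)) * g (dyadic_pt n (Suc k)) - f (dyadic_pt n k) * g (dyadic_pt n k))"
    unfolding left_sum_dyadic_pt sum.distrib[symmetric]
    by (rule sum.cong) (auto simp: dyadic_incr_def algebra_simps)
  also have "\<dots> = f (dyadic_pt n m) * g (dyadic_pt n m) - f 0 * g 0"
    by (subst sum_lessThan_telescope) (simp add: dyadic_pt_def)
  finally show ?thesis .
qed

text \<open>
  Young's inequality suffices here in place of Hoelder's, because both power variations
  tend to \<open>0\<close>. The bound is uniform in the upper summation limit.
\<close>
lemma bracket_le_power_variation:
  assumes "p > 1" "q > 1" "1 / p + 1 / q = 1" "m \<le> 2 ^ n"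
  shows "\<bar>\<Sum>k<m. dyadic_incr f n k * dyadic_incr g n k\<bar>
    \<le> power_variation p f n / p + power_variation q g n / q"
proof -
  have "\<bar>\<Sum>k<m. dyadic_incr f n k * dyadic_incr g n k\<bar>
      \<le> (\<Sum>k<m. \<bar>dyadic_incr f n k\<bar> * \<bar>dyadic_incr g n k\<bar>)"
    by (rule order_trans[OF sum_abs]) (simp add: abs_mult)
  also have "\<dots> \<le> (\<Sum>k<2 ^ n. \<bar>dyadic_incr f n k\<bar> * \<bar>dyadic_incr g n k\<bar>)"
    using assms by (intro sum_mono2) auto
  also have "\<dots> \<le> (\<Sum>k<2 ^ n. \<bar>dyadic_incr f n k\<bar> powr p / p + \<bar>dyadic_incr g n k\<bar> powr q / q)"
    using assms by (intro sum_mono Youngs_inequality) auto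
  finally show ?thesis
    by (simp add: power_variation_def sum.distrib sum_divide_distrib)
qed

lemma left_sums_add_tendsto:
  assumes "p > 1" "q > 1" "1 / p + 1 / q = 1"
    and "in_lp p {-1..} (level_energy p f)" "in_lp q {-1..} (level_energy q g)"
    and "t \<in> dyadic_set"
  shows "(\<lambda>j. left_sum f g t (dyadic_level t + j) + left_sum g f t (dyadic_level t + j))
    \<longlonglongrightarrow> f t * g t - f 0 * g 0"
proof -
  let ?S = "\<lambda>n. left_sum f g t n + left_sum g f t n"
  let ?V = "\<lambda>n. power_variation p f n / p + power_variation q g n / q"
  have "?V \<longlonglongrightarrow> 0 / p + 0 / q"
    using assms by (intro tendsto_intros power_variation_tendsto_0) auto
  then have V: "?V \<longlonglongrightarrow> 0" by simp
  have "\<forall>\<^sub>F n in sequentially. norm (?S n - (f t * g t - f 0 * g 0)) \<le> ?V n"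
    using eventually_ge_at_top[of "dyadic_level t"]
  proof eventually_elim
    case (elim n)
    then have "t \<in> dyadic_grid n"
      using dyadic_grid_dyadic_level[OF assms(6)] dyadic_grid_mono by blast
    then obtain m where "m \<le> 2 ^ n" "t = dyadic_pt n m"
      by (auto simp: dyadic_grid_def)
    then show ?case
      using left_sums_by_parts[of f g n m] bracket_le_power_variation[OF assms(1-3), of m n f g]
      by simp
  qed
  then have "(\<lambda>n. ?S n - (f t * g t - f 0 * g 0)) \<longlonglongrightarrow> 0"
    using V by (rule Lim_null_comparison)
  then have "?S \<longlonglongrightarrow> f t * g t - f 0 * g 0"
    by (rule LIM_zero_cancel)
  then show ?thesis
    using LIMSEQ_ignore_initial_segment[of ?S _ "dyadic_level t"] by (simp add: add.commute)
qed

lemma dyadic_integral_by_parts: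
  assumes "p > 1" "q > 1" "1 / p + 1 / q = 1"
    and "in_lp p {-1..} (level_energy p f)" "in_lp q {-1..} (level_energy q g)"
    and "t \<in> dyadic_set" "dyadic_integrable f g t"
  shows "dyadic_integrable g f t"
    and "dyadic_integral g f t = f t * g t - f 0 * g 0 - dyadic_integral f g t"
proof -
  have "(\<lambda>j. left_sum f g t (dyadic_level t + j)) \<longlonglongrightarrow> dyadic_integral f g t"
    using assms(7) by (simp add: dyadic_integrable_def dyadic_integral_def convergent_LIMSEQ_iff)
  from tendsto_diff[OF left_sums_add_tendsto[OF assms(1-6)] this]
  have lim: "(\<lambda>j. left_sum g f t (dyadic_level t + j))
      \<longlonglongrightarrow> f t * g t - f 0 * g 0 - dyadic_integral f g t"
    by simp
  then show "dyadic_integrable g f t"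
    unfolding dyadic_integrable_def by (rule convergentI)
  show "dyadic_integral g f t = f t * g t - f 0 * g 0 - dyadic_integral f g t"
    unfolding dyadic_integral_def[of g] using lim by (rule limI)
qed

theorem theorem3p15:
  fixes p q :: real and f g :: "real \<Rightarrow> real"
  assumes "p > 1" and "q > 1" and "1 / p + 1 / q = 1"
    and "continuous_on {0..1} f" and "continuous_on {0..1} g"
    and "in_lp p {-1..} (level_energy p f)"
    and "in_lp q {-1..} (level_energy q g)"
    and "FS_integral_exists f g"
  shows "FS_integral_exists g f
    \<and> (\<exists>!h. continuous_extension (dyadic_integral g f) h)
    \<and> (\<forall>t\<in>{0..1}. FS_integral g f t = f t * g t - f 0 * g 0 - FS_integral f g t)
    \<and> (\<forall>s\<in>{0..1}. \<forall>t\<in>{0..1}.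
          FS_integral_between f g s t + FS_integral_between g f s t = f t * g t - f s * g s)"
proof -
  obtain h where h: "continuous_extension (dyadic_integral f g) h"
    using assms(8) by (auto simp: FS_integral_exists_def)
  define h' where "h' = (\<lambda>t\<in>{0..1}. f t * g t - f 0 * g 0 - h t)"
  note by_parts = dyadic_integral_by_parts[OF assms(1-3,6,7)]
  have integrable: "dyadic_integrable f g t" if "t \<in> dyadic_set" for t
    using assms(8) that by (auto simp: FS_integral_exists_def)
  have "continuous_on {0..1} (\<lambda>t. f t * g t - f 0 * g 0 - h t)"
    using assms(4,5) h by (auto simp: continuous_extension_def intro!: continuous_intros)
  then have "continuous_on {0..1} h'"
    by (rule continuous_on_eq) (simp add: h'_def)
  moreover have "h' t = dyadic_integral g f t" if "t \<in> dyadic_set" for t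
    using that h by_parts(2)[OF that integrable[OF that]] dyadic_set_subset
    by (auto simp: h'_def continuous_extension_def)
  ultimately have h': "continuous_extension (dyadic_integral g f) h'"
    by (simp add: continuous_extension_def h'_def)
  have "FS_integral_exists g f"
    using h' by_parts(1) integrable by (auto simp: FS_integral_exists_def)
  moreover have "\<exists>!h. continuous_extension (dyadic_integral g f) h"
    using h' continuous_extension_unique by blast
  moreover have formula: "\<forall>t\<in>{0..1}. FS_integral g f t = f t * g t - f 0 * g 0 - FS_integral f g t"
    by (simp add: FS_integral_eqI[OF h] FS_integral_eqI[OF h'] h'_def)
  moreover have "\<forall>s\<in>{0..1}. \<forall>t\<in>{0..1}.
      FS_integral_between f g s t + FS_integral_between g f s t = f t * g t - f s * g s"
    using formula by (simp add: FS_integral_between_def)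
  ultimately show ?thesis by blast
qed

end
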